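(* Let $R>0$, let $P_0$ be an arbitrary probability distribution on $[0,R]$ with strictly positive density, and let $r_1^*,r_2^*,\ldots$ be drawn i.i.d. from a continuous probability distribution $\mathcal{D}$ on $[0,R]$ (i.e. one with continuous cumulative distribution function). Run the regularized-belief algorithm with prior $P_0$ and step sizes $\lambda_t=1/\sqrt{t}$. Then for any fixed $t\ge 2$ and $\delta\in(0,1)$, with probability at least $1-\delta$ over the randomness of $r^*_{1:t-1}$, we have for all $\alpha\in[0,1]$ simultaneously $$\alpha-\sqrt{\frac{\log(2/\delta)}{2(t-1)}}-\frac{1}{\sqrt{t}-1}\le\mathbb{P}_{r_t^*\sim\mathcal{D}}\left[r_t^*\le r_t(\alpha)\right]\le\alpha+\sqrt{\frac{\log(2/\delta)}{2(t-1)}}+\frac{1}{\sqrt{t}-1}+\frac{1}{t-1},$$ where the probability in the middle is over $r_t^*$ only, with $r_{1:t-1}^*$ (hence $r_t(\alpha)$) held fixed.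
   Context: Quantile: for a probability distribution $P$ on $[0,R]$, $q_\alpha(P)=\min\{x\in[0,R]:P([0,x])\ge\alpha\}$. $\bar P(r^*_{1:n})$ denotes the empirical distribution of $r_1^*,\ldots,r_n^*$. $\log$ is the natural logarithm. Regularized-belief algorithm: given the prior $P_0$ and step sizes $(\lambda_t)$ with $\lambda_1=1$ and $\lambda_t\in(0,1)$ for $t\ge2$, in round $t$ it forms $P_t=\lambda_tP_0+(1-\lambda_t)\bar P(r^*_{1:t-1})$ (so $P_1=P_0$), outputs $r_t(\alpha)=q_\alpha(P_t)$ for each $\alpha\in[0,1]$, and then observes $r_t^*\in[0,R]$. *)

theory Defs
  imports "HOL-Probability.Probability"
begin

definition distribution_on :: "real \<Rightarrow> real measure \<Rightarrow> bool" where
  "distribution_on R P \<longleftrightarrow> real_distribution P \<and> measure P {0..R} = 1"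

definition has_positive_density_on :: "real \<Rightarrow> real measure \<Rightarrow> bool" where
  "has_positive_density_on R P \<longleftrightarrow>
     (\<exists>f :: real \<Rightarrow> real. f \<in> borel_measurable borel \<and> (\<forall>x\<in>{0..R}. 0 < f x) \<and>
        P = density lborel (\<lambda>x. ennreal (f x * indicator {0..R} x)))"

text \<open>\<^const>\<open>Least\<close> expresses the minimum itself. For \<open>0 \<le> \<alpha> \<le> 1\<close> and \<open>P\<close> a distribution on
  \<open>[0, R]\<close> it is attained, because \<open>\<lambda>x. P [0, x]\<close> is right-continuous.\<close>

definition quantile :: "real \<Rightarrow> real measure \<Rightarrow> real \<Rightarrow> real" where
  "quantile R P \<alpha> = (LEAST x. x \<in> {0..R} \<and> \<alpha> \<le> measure P {0..x})"

text \<open>For \<open>n = 0\<close> this is the zero measure; in the algorithm it then has weight \<open>0\<close>.\<close>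

definition empirical_distribution :: "nat \<Rightarrow> (nat \<Rightarrow> real) \<Rightarrow> real measure" where
  "empirical_distribution n r = distr (uniform_count_measure {1..n}) borel r"

definition mixture :: "real \<Rightarrow> real measure \<Rightarrow> real measure \<Rightarrow> real measure" where
  "mixture c P Q = measure_of UNIV (sets borel)
     (\<lambda>A. ennreal c * emeasure P A + ennreal (1 - c) * emeasure Q A)"

text \<open>The set function in \<^const>\<open>mixture\<close> is a measure, so that \<^const>\<open>measure_of\<close> does not
  collapse to the zero measure:\<close>

lemma sets_mixture [simp]: "sets (mixture c P Q) = sets borel"
  unfolding mixture_def by (metis sets.sets_measure_of_eq space_borel)

lemma space_mixture [simp]: "space (mixture c P Q) = UNIV"
  unfolding mixture_def by (simp add: space_measure_of_conv)

lemma emeasure_mixture: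
  assumes "sets P = sets borel" "sets Q = sets borel" "A \<in> sets borel"
  shows "emeasure (mixture c P Q) A = ennreal c * emeasure P A + ennreal (1 - c) * emeasure Q A"
proof (rule emeasure_measure_of[OF mixture_def])
  let ?\<mu> = "\<lambda>A. ennreal c * emeasure P A + ennreal (1 - c) * emeasure Q A"
  show "positive (sets (mixture c P Q)) ?\<mu>"
    by (simp add: positive_def)
  show "countably_additive (sets (mixture c P Q)) ?\<mu>"
  proof (rule countably_additiveI)
    fix B :: "nat \<Rightarrow> real set"
    assume B: "range B \<subseteq> sets (mixture c P Q)" "disjoint_family B"
    then have "(\<Sum>i. emeasure P (B i)) = emeasure P (\<Union>i. B i)"
      and "(\<Sum>i. emeasure Q (B i)) = emeasure Q (\<Union>i. B i)"
      using assms by (auto intro!: suminf_emeasure)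
    then show "(\<Sum>i. ?\<mu> (B i)) = ?\<mu> (\<Union>i. B i)"
      by (simp add: suminf_add[symmetric])
  qed
qed (use assms in auto)

text \<open>In round \<open>t \<ge> 1\<close> the algorithm has seen \<open>r 1, \<dots>, r (t - 1)\<close>; \<open>lam\<close> are the step sizes.\<close>

definition regularized_belief ::
    "(nat \<Rightarrow> real) \<Rightarrow> real measure \<Rightarrow> (nat \<Rightarrow> real) \<Rightarrow> nat \<Rightarrow> real measure" where
  "regularized_belief lam P0 r t = mixture (lam t) P0 (empirical_distribution (t - 1) r)"

definition algorithm_output ::
    "real \<Rightarrow> (nat \<Rightarrow> real) \<Rightarrow> real measure \<Rightarrow> (nat \<Rightarrow> real) \<Rightarrow> nat \<Rightarrow> real \<Rightarrow> real" where
  "algorithm_output R lam P0 r t \<alpha> = quantile R (regularized_belief lam P0 r t) \<alpha>"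

end

theory Submission imports Defs "HOL-Real_Asymp.Real_Asymp" begin

text \<open>
  Both deviations of the empirical distribution function are exceedances along a chain of sets
  (half-lines) \<open>A\<close>: the number \<open>N A\<close> of the \<open>n\<close> sample points in \<open>A\<close> is larger than \<open>n (\<mu> A + e)\<close>.
  For \<open>a > 0\<close> the process \<open>(1 + a / \<mu> A) ^ N A\<close> is a martingale as \<open>A\<close> decreases along the chain, with
  expectation \<open>(1 + a) ^ n\<close>. A single \<open>a\<close>, depending only on \<open>e\<close>, satisfies
  \<open>(v + e) ln (1 + a / v) \<ge> ln (1 + a) + 2 e\<^sup>2\<close> for all \<open>v > 0\<close>: take the exponential tilt that is optimal
  at the minimiser \<open>u\<close> of the relative entropy of Bernoulli\<open>(u + e)\<close> with respect to Bernoulli\<open>(u)\<close>.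
  Stopping the martingale at the first exceedance then gives the one-sided Dvoretzky-Kiefer-Wolfowitz
  bound \<open>exp (- 2 n e\<^sup>2)\<close> with Massart's constant. Mixing in the prior with weight \<open>c\<close> costs at most
  \<open>c / (1 - c) = 1 / (sqrt t - 1)\<close> on either side.
\<close>

subsection \<open>The tilting parameter\<close>

text \<open>The derivative of \<open>(v + e) ln (1 + a / v)\<close> in \<open>v\<close> has the sign of
  \<open>bennett_ratio (a / v) - e / a\<close>.\<close>

definition bennett_ratio :: "real \<Rightarrow> real" where
  "bennett_ratio y = ((1 + y) * ln (1 + y) - y) / y\<^sup>2"

text \<open>The right side minus the left has derivative
  \<open>ln (1 + x) + 1 / (1 + x) - 1\<close>, nonnegative by \<open>ln s \<le> s - 1\<close> at
  \<open>s = 1 / (1 + x)\<close>. This settles the sign of the derivative of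
  \<open>bennett_ratio\<close>.\<close>

lemma ln_one_plus_ge_Pade:
  fixes y :: real
  assumes "0 \<le> y"
  shows "2 * y \<le> (2 + y) * ln (1 + y)"
proof -
  let ?f = "\<lambda>y::real. (2 + y) * ln (1 + y) - 2 * y"
  have "?f 0 \<le> ?f y"
  proof (rule DERIV_nonneg_imp_nondecreasing[OF assms])
    fix x :: real assume x: "0 \<le> x" "x \<le> y"
    have "(?f has_real_derivative (ln (1 + x) + (2 + x) * (1 / (1 + x)) - 2)) (at x)"
      using x by (auto intro!: derivative_eq_intros)
    moreover have "ln (1 / (1 + x)) \<le> 1 / (1 + x) - 1"
      using x by (intro ln_le_minus_one) auto
    then have "0 \<le> ln (1 + x) + (2 + x) * (1 / (1 + x)) - 2"
      using x by (simp add: ln_div field_simps)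
    ultimately show "\<exists>d. DERIV ?f x :> d \<and> 0 \<le> d" by blast
  qed
  then show ?thesis by simp
qed

text \<open>The numerator of the derivative factors as
  \<open>z * (2 * z - (2 + z) * ln (1 + z))\<close>. Monotonicity is what turns the stationary point
  in \<open>ex_uniform_tilt\<close> into a global minimum.\<close>

lemma bennett_ratio_antimono:
  assumes "0 < x" "x \<le> y"
  shows "bennett_ratio y \<le> bennett_ratio x"
proof (rule DERIV_nonpos_imp_nonincreasing[OF assms(2)])
  fix z assume "x \<le> z" "z \<le> y"
  then have z: "0 < z" using assms by auto
  have "(bennett_ratio has_real_derivative
      ((ln (1 + z) * z\<^sup>2 - ((1 + z) * ln (1 + z) - z) * (2 * z)) / (z\<^sup>2)\<^sup>2)) (at z)"
    unfolding bennett_ratio_def using z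
    by (auto intro!: derivative_eq_intros simp: power2_eq_square)
  moreover have "ln (1 + z) * z\<^sup>2 - ((1 + z) * ln (1 + z) - z) * (2 * z) =
      z * (2 * z - (2 + z) * ln (1 + z))"
    by (simp add: algebra_simps power2_eq_square)
  then have "(ln (1 + z) * z\<^sup>2 - ((1 + z) * ln (1 + z) - z) * (2 * z)) / (z\<^sup>2)\<^sup>2 \<le> 0"
    using ln_one_plus_ge_Pade[of z] z by (auto intro!: divide_nonpos_nonneg mult_nonneg_nonpos)
  ultimately show "\<exists>d. DERIV bennett_ratio z :> d \<and> d \<le> 0" by blast
qed

text \<open>With \<open>bennett_ratio_less_1\<close> this places \<open>k = 1 - b\<close> strictly
  between 0 and 1 in \<open>ex_uniform_tilt\<close>.\<close>

lemma bennett_ratio_pos: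
  assumes "0 < y" shows "0 < bennett_ratio y"
proof -
  have "0 < y * ln (1 + y)" using assms by simp
  then have "y < (1 + y) * ln (1 + y)"
    using ln_one_plus_ge_Pade[of y] assms unfolding distrib_right by linarith
  then show ?thesis using assms by (simp add: bennett_ratio_def)
qed

lemma bennett_ratio_less_1:
  assumes "0 < y" shows "bennett_ratio y < 1"
proof -
  have "(1 + y) * ln (1 + y) < (1 + y) * y"
    using assms ln_add_one_self_less_self[of y] by (intro mult_strict_left_mono) auto
  then show ?thesis using assms by (simp add: bennett_ratio_def field_simps power2_eq_square)
qed

text \<open>Intermediate value theorem: the expression tends to 0 at 0, where the ratio tends to
  1/2, and to 1 at infinity, where the ratio decays like \<open>ln y / y\<close>. It is the
  deviation \<open>e\<close> that the parametrisation in \<open>ex_uniform_tilt\<close> assigns to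
  \<open>y = a / u\<close>.\<close>

lemma ex_bennett_ratio:
  assumes "0 < e" "e < 1"
  obtains y where "0 < y"
    "e = (1 - bennett_ratio y) * (y * bennett_ratio y) / (1 + y * bennett_ratio y)"
proof -
  let ?f = "\<lambda>y. (1 - bennett_ratio y) * (y * bennett_ratio y) / (1 + y * bennett_ratio y)"
  have "(?f \<longlongrightarrow> 0) (at_right 0)"
    unfolding bennett_ratio_def by real_asymp
  then have "eventually (\<lambda>y. ?f y < e) (at_right 0)"
    using assms by (intro order_tendstoD)
  then obtain b where b: "b > 0" "\<And>y. 0 < y \<Longrightarrow> y < b \<Longrightarrow> ?f y < e"
    by (auto simp: eventually_at_right_field)
  have "(?f \<longlongrightarrow> 1) at_top"
    unfolding bennett_ratio_def by real_asymp
  then have "eventually (\<lambda>y. e < ?f y) at_top"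
    using assms by (intro order_tendstoD)
  then obtain c where c: "\<And>y. y \<ge> c \<Longrightarrow> e < ?f y"
    by (auto simp: eventually_at_top_linorder)
  have cont: "continuous_on {b/2..max b c} ?f"
  proof -
    have "1 + y * bennett_ratio y \<noteq> 0" if "y > 0" for y
      using bennett_ratio_pos[OF that] that by (smt (verit) mult_pos_pos)
    moreover have "continuous_on {b/2..max b c} bennett_ratio"
      unfolding bennett_ratio_def using b by (auto intro!: continuous_intros)
    ultimately show ?thesis using b by (intro continuous_intros) auto
  qed
  have "?f (b/2) \<le> e" using b(2)[of "b/2"] b(1) by simp
  moreover have "e \<le> ?f (max b c)" using c[of "max b c"] by simp
  moreover have "b/2 \<le> max b c" using b(1) by (simp add: max_def)
  ultimately obtain y where "b/2 \<le> y" "?f y = e"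
    using IVT'[of ?f "b/2" e "max b c"] cont by blast
  then show ?thesis using b(1) that[of y] by simp
qed

text \<open>Gibbs' variational principle bounds the relative entropy below by
  \<open>k * h - ln S\<close>, where \<open>S\<close> is the moment generating function of
  Bernoulli(\<open>u\<close>) at \<open>h\<close>. Hoeffding's lemma bounds \<open>ln S\<close> from
  above.\<close>

lemma Pinsker_Bernoulli:
  fixes u k :: real
  assumes "0 < u" "u \<le> k" "k < 1"
  shows "2 * (k - u)\<^sup>2 \<le> k * ln (k / u) + (1 - k) * ln ((1 - k) / (1 - u))"
proof -
  \<comment> \<open>\<open>h\<close> maximises \<open>(k - u) h - h\<^sup>2 / 8\<close>, the lower bound that Hoeffding's lemma leaves.\<close>
  define h where "h = 4 * (k - u)"
  define S where "S = 1 + u * (exp h - 1)"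
  have h: "0 \<le> h" using assms by (simp add: h_def)
  have S: "0 < S" using assms h by (simp add: S_def add_pos_nonneg)
  have "- h * u + ln S \<le> h\<^sup>2 / 8"
    using Hoeffdings_lemma_aux[of h u] h assms by (simp add: S_def)
  moreover have "k * h - ln S \<le> k * ln (k / u) + (1 - k) * ln ((1 - k) / (1 - u))"
  proof -
    \<comment> \<open>Gibbs' inequality for Bernoulli(\<open>k\<close>) against the tilted law with
      probabilities \<open>u * exp h / S\<close> and \<open>(1 - u) / S\<close>.\<close>
    have "k * ln (u * exp h / (k * S)) + (1 - k) * ln ((1 - u) / ((1 - k) * S))
        \<le> k * (u * exp h / (k * S) - 1) + (1 - k) * ((1 - u) / ((1 - k) * S) - 1)"
      using assms S by (intro add_mono mult_left_mono ln_le_minus_one) auto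
    also have "\<dots> = (u * exp h + (1 - u)) / S - 1"
      using assms S by (simp add: field_simps)
    also have "\<dots> = 0"
      using S by (simp add: S_def algebra_simps)
    finally have "k * ln (u * exp h / (k * S)) + (1 - k) * ln ((1 - u) / ((1 - k) * S)) \<le> 0" .
    moreover have "ln (u * exp h / (k * S)) = h - ln (k / u) - ln S"
      using assms S by (simp add: ln_mult ln_div)
    moreover have "ln ((1 - u) / ((1 - k) * S)) = - ln ((1 - k) / (1 - u)) - ln S"
      using assms S by (simp add: ln_mult ln_div del: left_diff_distrib')
    ultimately have "k * (h - ln (k / u) - ln S) + (1 - k) * (- ln ((1 - k) / (1 - u)) - ln S) \<le> 0"
      by (simp only:)
    then show ?thesis by (simp add: algebra_simps)
  qed
  moreover have "k * h - h * u - h\<^sup>2 / 8 = 2 * (k - u)\<^sup>2"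
    by (simp add: h_def power2_eq_square field_simps)
  ultimately show ?thesis by linarith
qed

text \<open>For suitable \<open>a\<close> the right side is smallest at a point \<open>u\<close>
  where \<open>1 + a / u\<close> is also the optimal exponential tilt. There its excess over
  \<open>ln (1 + a)\<close> is a relative entropy between Bernoulli laws at distance
  \<open>e\<close>, so the bound at \<open>u\<close> carries over to every \<open>v\<close>.\<close>

lemma ex_uniform_tilt:
  fixes e :: real
  assumes "0 < e" "e < 1"
  obtains a where "0 < a" "\<And>v. 0 < v \<Longrightarrow> ln (1 + a) + 2 * e\<^sup>2 \<le> (v + e) * ln (1 + a / v)"
proof -
  obtain y where y: "0 < y"
    and e: "e = (1 - bennett_ratio y) * (y * bennett_ratio y) / (1 + y * bennett_ratio y)"
    using ex_bennett_ratio[OF assms] .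
  define b where "b = bennett_ratio y"
  have b: "0 < b" "b < 1"
    using y bennett_ratio_pos bennett_ratio_less_1 by (auto simp: b_def)
  have yb: "0 < 1 + y * b" using y b by (simp add: add_pos_pos)
  \<comment> \<open>Solving \<open>a = e / (1 - k)\<close> (the optimal tilt at \<open>u\<close>, where \<open>k = u + e\<close>) together with the
    stationarity condition \<open>bennett_ratio (a / u) = e / a\<close> in terms of \<open>y = a / u\<close>.\<close>
  define k where "k = 1 - b"
  define u where "u = k / (1 + y * b)"
  define a where "a = y * u"
  have k: "0 < k" "k < 1" using b by (auto simp: k_def)
  have u: "0 < u" using k yb by (simp add: u_def)
  have a: "0 < a" using y u by (simp add: a_def)
  have e': "e = u * (y * b)" using e by (simp add: u_def k_def b_def)
  have ku: "k = u * (1 + y * b)" using yb by (simp add: u_def)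
  then have ke: "k = u + e" by (simp add: e' algebra_simps)
  have "u < k" using ke assms by simp
  have "1 + a = (1 - u) / (1 - k)"
  proof -
    have "b * (1 + a) = b + e" by (simp add: a_def e' algebra_simps)
    then show ?thesis using b ke by (simp add: k_def field_simps)
  qed
  have "1 + a / u = k * (1 - u) / (u * (1 - k))"
  proof -
    have "1 + a / u = 1 + y" using u by (simp add: a_def)
    moreover have "k * (1 - u) = (1 + y) * (u * (1 - k))"
    proof -
      have "(1 + y * b) * (1 - u) = (1 + y) * (1 - k)"
        using ku by (simp add: k_def algebra_simps)
      then show ?thesis by (metis ku mult.assoc mult.left_commute)
    qed
    ultimately show ?thesis using u k by (simp add: field_simps)
  qed
  \<comment> \<open>Optimality of the tilt makes \<open>k * ln (1 + a / u) - ln (1 + a)\<close>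
    equal to the relative entropy, so Pinsker's inequality applies.\<close>
  have val: "ln (1 + a) + 2 * e\<^sup>2 \<le> (u + e) * ln (1 + a / u)"
  proof -
    have "2 * e\<^sup>2 \<le> k * ln (k / u) + (1 - k) * ln ((1 - k) / (1 - u))"
      using Pinsker_Bernoulli[of u k] u k \<open>u < k\<close> ke by simp
    also have "\<dots> = k * ln (1 + a / u) - ln (1 + a)"
    proof -
      have "ln (1 + a / u) = ln (k / u) - ln ((1 - k) / (1 - u))"
        unfolding \<open>1 + a / u = _\<close> using u k \<open>u < k\<close>
        by (simp add: ln_mult ln_div del: right_diff_distrib' left_diff_distrib')
      moreover have "ln (1 + a) = - ln ((1 - k) / (1 - u))"
        unfolding \<open>1 + a = _\<close> using k \<open>u < k\<close> by (simp add: ln_div)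
      ultimately have "k * ln (1 + a / u) - ln (1 + a) =
          k * (ln (k / u) - ln ((1 - k) / (1 - u))) - (- ln ((1 - k) / (1 - u)))"
        by (simp only:)
      then show ?thesis by (simp add: algebra_simps)
    qed
    finally show ?thesis by (simp add: ke)
  qed
  let ?g = "\<lambda>v. (v + e) * ln (1 + a / v)"
  have deriv: "(?g has_real_derivative
      (a / v)\<^sup>2 / (1 + a / v) * (bennett_ratio (a / v) - bennett_ratio y)) (at v)"
    if "0 < v" for v
  proof -
    have "(?g has_real_derivative
      (ln (1 + a / v) + (v + e) * (- (a / v\<^sup>2) / (1 + a / v)))) (at v)"
      using that a by (auto intro!: derivative_eq_intros simp: power2_eq_square add_pos_pos ac_simps)
    moreover have "ln (1 + a / v) + (v + e) * (- (a / v\<^sup>2) / (1 + a / v)) =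
      (a / v)\<^sup>2 / (1 + a / v) * (bennett_ratio (a / v) - bennett_ratio y)"
    proof -
      define z where "z = a / v"
      have z: "0 < z" "v = a / z" using a that by (auto simp: z_def)
      have "e = a * b" by (simp add: a_def e')
      then have "(v + e) * (a / v\<^sup>2) = z + b * z\<^sup>2"
        using z(1) a by (simp add: z(2) field_simps power2_eq_square)
      then have "ln (1 + z) + (v + e) * (- (a / v\<^sup>2) / (1 + z)) =
          ln (1 + z) - (z + b * z\<^sup>2) / (1 + z)"
        by (metis minus_divide_left mult_minus_right times_divide_eq_right uminus_add_conv_diff add.commute)
      also have "\<dots> = ((1 + z) * ln (1 + z) - z - b * z\<^sup>2) / (1 + z)"
        using z(1) by (simp add: diff_divide_distrib add_divide_distrib)
      also have "(1 + z) * ln (1 + z) - z = z\<^sup>2 * bennett_ratio z"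
        using z(1) by (simp add: bennett_ratio_def)
      also have "(z\<^sup>2 * bennett_ratio z - b * z\<^sup>2) / (1 + z) =
          z\<^sup>2 / (1 + z) * (bennett_ratio z - b)"
        by (simp add: algebra_simps)
      finally show ?thesis by (simp only: z_def b_def)
    qed
    ultimately show ?thesis by (simp only:)
  qed
  \<comment> \<open>\<open>a / v\<close> decreases through \<open>y\<close> at \<open>v = u\<close>
    and \<open>bennett_ratio\<close> is antitone, so the derivative of \<open>?g\<close> turns from
    nonpositive to nonnegative there.\<close>
  have "?g u \<le> ?g v" if v: "0 < v" for v
  proof (cases "u \<le> v")
    case True
    show ?thesis
    proof (rule DERIV_nonneg_imp_nondecreasing[OF True])
      fix x assume x: "u \<le> x" "x \<le> v"
      then have "0 < x" using u by simp
      moreover have "a / x \<le> y"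
        unfolding a_def using x u y by (simp add: pos_divide_le_eq[OF \<open>0 < x\<close>] mult_left_mono)
      ultimately have "bennett_ratio y \<le> bennett_ratio (a / x)"
        using bennett_ratio_antimono[of "a / x" y] a by simp
      then have "0 \<le> (a / x)\<^sup>2 / (1 + a / x) * (bennett_ratio (a / x) - bennett_ratio y)"
        using a \<open>0 < x\<close> by simp
      then show "\<exists>d. DERIV ?g x :> d \<and> 0 \<le> d"
        using deriv[OF \<open>0 < x\<close>] by blast
    qed
  next
    case False
    then have "v \<le> u" by simp
    show ?thesis
    proof (rule DERIV_nonpos_imp_nonincreasing[OF \<open>v \<le> u\<close>])
      fix x assume x: "v \<le> x" "x \<le> u"
      then have "0 < x" using v by simp
      moreover have "y \<le> a / x"
        unfolding a_def using x u y by (simp add: pos_le_divide_eq[OF \<open>0 < x\<close>] mult_left_mono)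
      ultimately have "bennett_ratio (a / x) \<le> bennett_ratio y"
        using bennett_ratio_antimono[of y "a / x"] y by simp
      then have "(a / x)\<^sup>2 / (1 + a / x) * (bennett_ratio (a / x) - bennett_ratio y) \<le> 0"
        using a \<open>0 < x\<close> by (intro mult_nonneg_nonpos) auto
      then show "\<exists>d. DERIV ?g x :> d \<and> d \<le> 0"
        using deriv[OF \<open>0 < x\<close>] by blast
    qed
  qed
  then show ?thesis using val a by (intro that[of a]) (auto intro: order_trans)
qed

subsection \<open>The maximal inequality along a chain of sets\<close>

text \<open>The martingale property: for \<open>w'\<close> constant on \<open>A\<close>, the product of the \<open>w'\<close> is the conditional
  expectation of the product of the \<open>w\<close> when the points in \<open>A\<close> are not distinguished.\<close>

lemma (in prob_space) nn_integral_PiM_prod_replace: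
  fixes w w' :: "'a \<Rightarrow> ennreal" and H :: "('i \<Rightarrow> 'a) \<Rightarrow> ennreal"
  assumes "finite I"
    and [measurable]: "w \<in> borel_measurable M" "w' \<in> borel_measurable M" "A \<in> sets M"
    and H: "H \<in> borel_measurable (PiM I (\<lambda>_. M))"
    and const: "\<And>x i y y'. x \<in> space (PiM I (\<lambda>_. M)) \<Longrightarrow> i \<in> I \<Longrightarrow> y \<in> A \<Longrightarrow> y' \<in> A \<Longrightarrow>
      H (x(i := y)) = H (x(i := y'))"
    and off: "\<And>y. y \<in> space M - A \<Longrightarrow> w y = w' y"
    and on: "(\<integral>\<^sup>+y\<in>A. w y \<partial>M) = (\<integral>\<^sup>+y\<in>A. w' y \<partial>M)"
  shows "(\<integral>\<^sup>+x. (\<Prod>i\<in>I. w (x i)) * H x \<partial>PiM I (\<lambda>_. M)) =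
    (\<integral>\<^sup>+x. (\<Prod>i\<in>I. w' (x i)) * H x \<partial>PiM I (\<lambda>_. M))"
  using \<open>finite I\<close> H const
proof (induction I arbitrary: H)
  case empty
  show ?case by simp
next
  case (insert i I)
  interpret product_sigma_finite "\<lambda>_. M" ..
  note [measurable] = insert.prems(1)
  have space_upd: "x(i := y) \<in> space (PiM (insert i I) (\<lambda>_. M))"
    if "x \<in> space (PiM I (\<lambda>_. M))" "y \<in> space M" for x y
    using that by (auto simp: space_PiM PiE_def extensional_def)
  have [measurable]: "(\<lambda>y. H (x(i := y))) \<in> borel_measurable M" if [measurable]: "x \<in> space (PiM I (\<lambda>_. M))" for x
    using that by measurable
  \<comment> \<open>On \<open>A\<close> the factor \<open>H\<close> is a constant \<open>c\<close>,
    so only the integral of the weight over \<open>A\<close> matters; off \<open>A\<close> the two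
    weights agree pointwise.\<close>
  have split: "(\<integral>\<^sup>+y. v y * H (x(i := y)) \<partial>M) =
      (\<integral>\<^sup>+y. v y * indicator A y \<partial>M) * c + (\<integral>\<^sup>+y. v y * H (x(i := y)) * indicator (space M - A) y \<partial>M)"
    if x: "x \<in> space (PiM I (\<lambda>_. M))" and c: "\<And>y. y \<in> A \<Longrightarrow> H (x(i := y)) = c"
      and [measurable]: "v \<in> borel_measurable M" for v x c
  proof -
    note [measurable] = x
    have "(\<integral>\<^sup>+y. v y * H (x(i := y)) \<partial>M) =
      (\<integral>\<^sup>+y. v y * indicator A y * c + v y * H (x(i := y)) * indicator (space M - A) y \<partial>M)"
      by (intro nn_integral_cong) (auto simp: c split: split_indicator)
    also have "\<dots> = (\<integral>\<^sup>+y. v y * indicator A y * c \<partial>M) + (\<integral>\<^sup>+y. v y * H (x(i := y)) * indicator (space M - A) y \<partial>M)"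
      by (intro nn_integral_add) measurable
    finally show ?thesis by (simp add: nn_integral_multc)
  qed
  have inner: "(\<integral>\<^sup>+y. w y * H (x(i := y)) \<partial>M) = (\<integral>\<^sup>+y. w' y * H (x(i := y)) \<partial>M)"
    if x: "x \<in> space (PiM I (\<lambda>_. M))" for x
  proof -
    obtain c where c: "\<And>y. y \<in> A \<Longrightarrow> H (x(i := y)) = c"
    proof (cases "A = {}")
      case False
      then obtain y0 where y0: "y0 \<in> A" by auto
      have "H (x(i := y)) = H (x(i := y0))" if "y \<in> A" for y
        using insert.prems(2)[of "x(i := y0)" i y y0] space_upd[OF x, of y0] that y0
          sets.sets_into_space[OF assms(4)]
        by (metis fun_upd_upd insertI1 subsetD)
      then show ?thesis using that by blast
    qed (use that in auto)
    have "(\<integral>\<^sup>+y. w y * H (x(i := y)) * indicator (space M - A) y \<partial>M) =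
        (\<integral>\<^sup>+y. w' y * H (x(i := y)) * indicator (space M - A) y \<partial>M)"
      by (intro nn_integral_cong) (auto simp: off split: split_indicator)
    then show ?thesis
      using split[OF x c assms(2)] split[OF x c assms(3)] on by simp
  qed
  \<comment> \<open>Coordinate \<open>i\<close> is integrated out with the new weight
    \<open>w'\<close>. \<open>H2\<close> inherits the constancy on \<open>A\<close> from
    \<open>H\<close>, so the induction hypothesis replaces the remaining weights.\<close>
  define H2 where "H2 x = (\<integral>\<^sup>+y. w' y * H (x(i := y)) \<partial>M)" for x
  have [measurable]: "H2 \<in> borel_measurable (PiM I (\<lambda>_. M))"
    unfolding H2_def by measurable
  have step: "(\<integral>\<^sup>+x. (\<Prod>j\<in>insert i I. v (x j)) * H x \<partial>PiM (insert i I) (\<lambda>_. M)) =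
      (\<integral>\<^sup>+x. (\<Prod>j\<in>I. v (x j)) * (\<integral>\<^sup>+y. v y * H (x(i := y)) \<partial>M) \<partial>PiM I (\<lambda>_. M))"
    if [measurable]: "v \<in> borel_measurable M" for v
  proof -
    have "(\<integral>\<^sup>+x. (\<Prod>j\<in>insert i I. v (x j)) * H x \<partial>PiM (insert i I) (\<lambda>_. M)) =
      (\<integral>\<^sup>+x. (\<integral>\<^sup>+y. (\<Prod>j\<in>insert i I. v ((x(i := y)) j)) * H (x(i := y)) \<partial>M) \<partial>PiM I (\<lambda>_. M))"
      using insert.hyps by (intro product_nn_integral_insert) auto
    also have "\<dots> = (\<integral>\<^sup>+x. (\<integral>\<^sup>+y. (\<Prod>j\<in>I. v (x j)) * (v y * H (x(i := y))) \<partial>M) \<partial>PiM I (\<lambda>_. M))"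
    proof (intro nn_integral_cong)
      fix x y
      have "(\<Prod>j\<in>I. v ((x(i := y)) j)) = (\<Prod>j\<in>I. v (x j))"
        using insert.hyps by (intro prod.cong) auto
      then show "(\<Prod>j\<in>insert i I. v ((x(i := y)) j)) * H (x(i := y)) =
          (\<Prod>j\<in>I. v (x j)) * (v y * H (x(i := y)))"
        using insert.hyps by (simp add: ac_simps)
    qed
    also have "\<dots> = (\<integral>\<^sup>+x. (\<Prod>j\<in>I. v (x j)) * (\<integral>\<^sup>+y. v y * H (x(i := y)) \<partial>M) \<partial>PiM I (\<lambda>_. M))"
      by (intro nn_integral_cong nn_integral_cmult) measurable
    finally show ?thesis .
  qed
  have "(\<integral>\<^sup>+x. (\<Prod>j\<in>insert i I. w (x j)) * H x \<partial>PiM (insert i I) (\<lambda>_. M)) =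
      (\<integral>\<^sup>+x. (\<Prod>j\<in>I. w (x j)) * H2 x \<partial>PiM I (\<lambda>_. M))"
    unfolding step[OF assms(2)] H2_def by (intro nn_integral_cong) (simp add: inner)
  also have "\<dots> = (\<integral>\<^sup>+x. (\<Prod>j\<in>I. w' (x j)) * H2 x \<partial>PiM I (\<lambda>_. M))"
  proof (rule insert.IH)
    fix x j y y'
    assume x: "x \<in> space (PiM I (\<lambda>_. M))" and j: "j \<in> I" and y: "y \<in> A" "y' \<in> A"
    have "H ((x(j := y))(i := z)) = H ((x(j := y'))(i := z))" if "z \<in> space M" for z
      using insert.prems(2)[of "x(i := z)" j y y'] space_upd[OF x that] j y insert.hyps
      by (metis fun_upd_twist insertCI)
    then show "H2 (x(j := y)) = H2 (x(j := y'))"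
      unfolding H2_def by (intro nn_integral_cong) simp
  qed measurable
  also have "\<dots> = (\<integral>\<^sup>+x. (\<Prod>j\<in>insert i I. w' (x j)) * H x \<partial>PiM (insert i I) (\<lambda>_. M))"
    unfolding step[OF assms(3)] H2_def ..
  finally show ?case .
qed

lemma finite_chain_has_least:
  assumes "finite \<A>" "\<A> \<noteq> {}" "\<And>A B. A \<in> \<A> \<Longrightarrow> B \<in> \<A> \<Longrightarrow> A \<subseteq> B \<or> B \<subseteq> A"
  obtains A0 where "A0 \<in> \<A>" "\<And>A. A \<in> \<A> \<Longrightarrow> A0 \<subseteq> A"
  using finite_has_minimal[OF assms(1,2)] assms(3) by (metis subset_antisym that)

text \<open>Optional stopping at the largest exceeded set. On each stopping event \<open>T A\<close>
  the product of the weights \<open>w A\<close> is at least \<open>K\<close>, and its integral there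
  is unchanged when \<open>w A\<close> becomes \<open>w A0\<close>. These events are disjoint, so
  the integrals add up to at most \<open>(1 + a) ^ n\<close>, and Markov's inequality
  finishes.\<close>

lemma (in prob_space) emeasure_chain_exceedance_finite:
  fixes e :: real and I :: "'i set"
  assumes "finite I" "finite \<A>" "\<A> \<subseteq> sets M"
    and chain: "\<And>A B. A \<in> \<A> \<Longrightarrow> B \<in> \<A> \<Longrightarrow> A \<subseteq> B \<or> B \<subseteq> A"
    and pos: "\<And>A. A \<in> \<A> \<Longrightarrow> 0 < prob A"
    and e: "0 < e" "e < 1"
  shows "emeasure (PiM I (\<lambda>_. M)) {x \<in> space (PiM I (\<lambda>_. M)).
      \<exists>A\<in>\<A>. card I * (prob A + e) < (\<Sum>i\<in>I. indicator A (x i))} \<le> exp (- 2 * real (card I) * e\<^sup>2)"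
proof (cases "\<A> = {}")
  case False
  interpret PI: product_prob_space "\<lambda>_. M" I ..
  let ?P = "PiM I (\<lambda>_. M)" and ?n = "real (card I)"
  obtain a where a: "0 < a" "\<And>v. 0 < v \<Longrightarrow> ln (1 + a) + 2 * e\<^sup>2 \<le> (v + e) * ln (1 + a / v)"
    using ex_uniform_tilt[OF e] by blast
  \<comment> \<open>The least set is the terminal time of the martingale: all stopped pieces are
    compared with its product.\<close>
  obtain A0 where A0: "A0 \<in> \<A>" "\<And>A. A \<in> \<A> \<Longrightarrow> A0 \<subseteq> A"
    using finite_chain_has_least[OF \<open>finite \<A>\<close> False chain] by blast
  define C where "C A x \<longleftrightarrow> ?n * (prob A + e) < (\<Sum>i\<in>I. indicator A (x i))" for A :: "'a set" and x :: "'i \<Rightarrow> 'a"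
  \<comment> \<open>\<open>T A\<close>: the martingale is stopped at \<open>A\<close>.\<close>
  define T where "T A x \<longleftrightarrow> C A x \<and> (\<forall>B\<in>\<A>. A \<subset> B \<longrightarrow> \<not> C B x)" for A :: "'a set" and x :: "'i \<Rightarrow> 'a"
  \<comment> \<open>The weight is \<open>1 + a / prob A\<close> on \<open>A\<close> and 1 elsewhere;
    the exponential form turns the product over the sample into an exponential of the count.\<close>
  define w where "w A y = ennreal (exp (indicator A y * ln (1 + a / prob A)))" for A and y :: 'a
  \<comment> \<open>The value that the martingale reaches at any exceedance;
    \<open>ex_uniform_tilt\<close> makes it independent of \<open>A\<close>.\<close>
  define K where "K = ennreal (exp (?n * (ln (1 + a) + 2 * e\<^sup>2)))"
  have [measurable]: "A \<in> sets M" if "A \<in> \<A>" for A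
    using that assms by auto
  have C_meas: "Measurable.pred ?P (C A)" if [measurable]: "A \<in> \<A>" for A
    unfolding C_def by measurable
  have T_meas [measurable]: "Measurable.pred ?P (T A)" if A [measurable]: "A \<in> \<A>" for A
  proof -
    have "Measurable.pred ?P (\<lambda>x. \<forall>B\<in>\<A>. A \<subset> B \<longrightarrow> \<not> C B x)"
      using \<open>finite \<A>\<close> C_meas by (intro pred_intros_finite pred_intros_imp' pred_intros_logic) auto
    then show ?thesis unfolding T_def using C_meas[OF A] by measurable
  qed
  have w_meas [measurable]: "w A \<in> borel_measurable M" if [measurable]: "A \<in> \<A>" for A
    unfolding w_def by measurable
  have w_eq: "w A y = 1 + ennreal (a / prob A) * indicator A y" if "A \<in> \<A>" for A y
  proof (cases "y \<in> A")
    case True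
    have "0 \<le> a / prob A" using a by simp
    then have "exp (ln (1 + a / prob A)) = 1 + a / prob A" by simp
    then have "w A y = ennreal (1 + a / prob A)" using True by (simp add: w_def)
    also have "\<dots> = 1 + ennreal (a / prob A)"
      using \<open>0 \<le> a / prob A\<close> by (subst ennreal_plus) auto
    finally show ?thesis using True by simp
  qed (simp add: w_def)
  \<comment> \<open>The value does not depend on \<open>A\<close>: each weight adds the same total
    mass \<open>a\<close>. This is the martingale identity behind \<open>swap\<close>.\<close>
  have int_w: "(\<integral>\<^sup>+y\<in>B. w A y \<partial>M) = ennreal (prob B + a)"
    if [measurable]: "A \<in> \<A>" "B \<in> \<A>" and "A \<subseteq> B" for A B
  proof -
    have p: "0 < 1 + a / prob A" "0 < prob A" using pos[of A] that a by (auto simp: add_pos_pos)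
    have "(\<integral>\<^sup>+y\<in>B. w A y \<partial>M) = (\<integral>\<^sup>+y. indicator B y + ennreal (a / prob A) * indicator A y \<partial>M)"
      using \<open>A \<subseteq> B\<close> by (intro nn_integral_cong) (auto simp: w_eq[OF \<open>A \<in> \<A>\<close>] split: split_indicator)
    also have "\<dots> = emeasure M B + ennreal (a / prob A) * emeasure M A"
      by (subst nn_integral_add) (auto simp: nn_integral_cmult)
    also have "\<dots> = ennreal (prob B + a)"
      using p a by (simp add: emeasure_eq_measure flip: ennreal_mult ennreal_plus)
    finally show ?thesis .
  qed
  have prod_w: "(\<Prod>i\<in>I. w A (x i)) = ennreal (exp ((\<Sum>i\<in>I. indicator A (x i)) * ln (1 + a / prob A)))"
    for A :: "'a set" and x :: "'i \<Rightarrow> 'a"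
    unfolding w_def sum_distrib_right exp_sum[OF \<open>finite I\<close>] by (intro prod_ennreal) simp
  have K_le: "K * indicator {x. T A x} x \<le> (\<Prod>i\<in>I. w A (x i)) * indicator {x. T A x} x"
    if A: "A \<in> \<A>" for A x
  proof (cases "T A x")
    case True
    have "?n * (ln (1 + a) + 2 * e\<^sup>2) \<le> ?n * (prob A + e) * ln (1 + a / prob A)"
      using a(2)[OF pos[OF A]] by (simp add: mult.assoc mult_left_mono)
    also have "\<dots> \<le> (\<Sum>i\<in>I. indicator A (x i)) * ln (1 + a / prob A)"
      using True a pos[OF A] by (intro mult_right_mono) (auto simp: T_def C_def)
    finally show ?thesis using True by (simp add: K_def prod_w)
  qed auto
  have swap: "(\<integral>\<^sup>+x. (\<Prod>i\<in>I. w A (x i)) * indicator {x. T A x} x \<partial>?P) =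
      (\<integral>\<^sup>+x. (\<Prod>i\<in>I. w A0 (x i)) * indicator {x. T A x} x \<partial>?P)" if A [measurable]: "A \<in> \<A>" for A
  proof (rule nn_integral_PiM_prod_replace[OF \<open>finite I\<close>, where A = A])
    \<comment> \<open>Moving a point within \<open>A\<close> changes no count of a superset of
      \<open>A\<close>, and \<open>T A\<close> looks only at \<open>A\<close> and its
      supersets.\<close>
    have C_upd: "C B (x(i := y)) = C B (x(i := y'))" if "y \<in> A" "y' \<in> A" "A \<subseteq> B" for B x i y y'
    proof -
      have "(\<Sum>j\<in>I. indicator B ((x(i := y)) j)) = (\<Sum>j\<in>I. indicator B ((x(i := y')) j) :: real)"
        using that by (intro sum.cong) (auto split: split_indicator)
      then show ?thesis by (simp only: C_def)
    qed
    fix x i y y' assume y: "y \<in> A" "y' \<in> A"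
    have "T A (x(i := y)) = T A (x(i := y'))"
      unfolding T_def
      by (intro arg_cong2[where f = conj] ball_cong imp_cong arg_cong[where f = Not] C_upd y) auto
    then show "indicator {x. T A x} (x(i := y)) = (indicator {x. T A x} (x(i := y')) :: ennreal)"
      by (simp add: indicator_def)
  next
    show "w A y = w A0 y" if "y \<in> space M - A" for y
      using that A0(2)[OF A] by (auto simp: w_def split: split_indicator)
    show "(\<integral>\<^sup>+y\<in>A. w A y \<partial>M) = (\<integral>\<^sup>+y\<in>A. w A0 y \<partial>M)"
      using int_w A0 A by simp
  qed (use A0 A in measurable)
  have union: "indicator {x \<in> space ?P. \<exists>A\<in>\<A>. C A x} x \<le> (\<Sum>A\<in>\<A>. indicator {x. T A x} x :: ennreal)" for x
  proof (cases "\<exists>A\<in>\<A>. C A x")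
    case True
    then obtain A where "A \<in> {A\<in>\<A>. C A x}" "\<forall>B\<in>{A\<in>\<A>. C A x}. A \<subseteq> B \<longrightarrow> A = B"
      using finite_has_maximal[of "{A\<in>\<A>. C A x}"] \<open>finite \<A>\<close> by auto
    then have A: "A \<in> \<A>" "T A x" by (auto simp: T_def)
    have "(indicator {x. T A x} x :: ennreal) \<le> (\<Sum>A\<in>\<A>. indicator {x. T A x} x)"
      using A \<open>finite \<A>\<close> by (intro member_le_sum) auto
    then show ?thesis using A by (auto split: split_indicator)
  qed auto
  \<comment> \<open>Of two different sets in the chain one is strictly larger, so both cannot be the
    largest exceeded set.\<close>
  have disj: "(\<Sum>A\<in>\<A>. indicator {x. T A x} x) \<le> (1 :: ennreal)" for x
  proof (cases "\<exists>A\<in>\<A>. T A x")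
    case True
    then obtain A where A: "A \<in> \<A>" "T A x" by auto
    have "\<not> T B x" if "B \<in> \<A>" "B \<noteq> A" for B
      using chain[OF A(1) that(1)] A that unfolding T_def by blast
    then have "(\<Sum>A\<in>\<A>. indicator {x. T A x} x) = (\<Sum>B\<in>\<A>. if B = A then 1 else 0 :: ennreal)"
      using A by (intro sum.cong) (auto split: split_indicator)
    then show ?thesis using A \<open>finite \<A>\<close> by simp
  qed auto
  have "K * emeasure ?P {x \<in> space ?P. \<exists>A\<in>\<A>. C A x} =
      (\<integral>\<^sup>+x. K * indicator {x \<in> space ?P. \<exists>A\<in>\<A>. C A x} x \<partial>?P)"
  proof -
    have "{x \<in> space ?P. \<exists>A\<in>\<A>. C A x} \<in> sets ?P"
      using \<open>finite \<A>\<close> C_meas by (intro pred_intros_finite predE) auto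
    then show ?thesis by (simp add: nn_integral_cmult)
  qed
  also have "\<dots> \<le> (\<integral>\<^sup>+x. (\<Sum>A\<in>\<A>. (\<Prod>i\<in>I. w A (x i)) * indicator {x. T A x} x) \<partial>?P)"
  proof (intro nn_integral_mono)
    fix x
    have "K * indicator {x \<in> space ?P. \<exists>A\<in>\<A>. C A x} x \<le> (\<Sum>A\<in>\<A>. K * indicator {x. T A x} x)"
      unfolding sum_distrib_left[symmetric] by (intro mult_left_mono union) auto
    also have "\<dots> \<le> (\<Sum>A\<in>\<A>. (\<Prod>i\<in>I. w A (x i)) * indicator {x. T A x} x)"
      by (intro sum_mono K_le)
    finally show "K * indicator {x \<in> space ?P. \<exists>A\<in>\<A>. C A x} x \<le> \<dots>" .
  qed
  also have "\<dots> = (\<Sum>A\<in>\<A>. \<integral>\<^sup>+x. (\<Prod>i\<in>I. w A0 (x i)) * indicator {x. T A x} x \<partial>?P)"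
    using A0 by (subst nn_integral_sum) (auto intro!: sum.cong swap)
  also have "\<dots> = (\<integral>\<^sup>+x. (\<Prod>i\<in>I. w A0 (x i)) * (\<Sum>A\<in>\<A>. indicator {x. T A x} x) \<partial>?P)"
    unfolding sum_distrib_left using A0(1) by (subst nn_integral_sum) auto
  also have "\<dots> \<le> (\<integral>\<^sup>+x. (\<Prod>i\<in>I. w A0 (x i)) * 1 \<partial>?P)"
    by (intro nn_integral_mono mult_left_mono disj) auto
  also have "\<dots> = (\<Prod>i\<in>I. \<integral>\<^sup>+y. w A0 y \<partial>M)"
    using PI.product_nn_integral_prod[of I "\<lambda>_. w A0"] A0(1) \<open>finite I\<close> by simp
  also have "(\<integral>\<^sup>+y. w A0 y \<partial>M) = ennreal (1 + a)"
  proof -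
    have p: "0 < prob A0" using pos A0 by auto
    have "(\<integral>\<^sup>+y. w A0 y \<partial>M) = (\<integral>\<^sup>+y. 1 + ennreal (a / prob A0) * indicator A0 y \<partial>M)"
      using A0(1) by (simp add: w_eq)
    also have "\<dots> = 1 + ennreal (a / prob A0) * emeasure M A0"
      using A0(1) by (subst nn_integral_add) (auto simp: nn_integral_cmult emeasure_space_1)
    also have "\<dots> = ennreal (1 + a)"
      using p a by (simp add: emeasure_eq_measure flip: ennreal_mult ennreal_plus ennreal_1)
    finally show ?thesis .
  qed
  finally have "K * emeasure ?P {x \<in> space ?P. \<exists>A\<in>\<A>. C A x} \<le> ennreal (exp (?n * ln (1 + a)))"
    using a by (simp add: exp_of_nat_mult flip: ennreal_power)
  then have "exp (?n * (ln (1 + a) + 2 * e\<^sup>2)) * measure ?P {x \<in> space ?P. \<exists>A\<in>\<A>. C A x} \<le>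
      exp (?n * ln (1 + a))"
    by (simp add: K_def PI.emeasure_eq_measure flip: ennreal_mult)
  then have "measure ?P {x \<in> space ?P. \<exists>A\<in>\<A>. C A x} \<le>
      exp (?n * ln (1 + a)) / exp (?n * (ln (1 + a) + 2 * e\<^sup>2))"
    by (simp add: field_simps)
  also have "\<dots> = exp (- 2 * ?n * e\<^sup>2)"
    by (simp add: exp_diff[symmetric] algebra_simps)
  finally show ?thesis unfolding C_def PI.emeasure_eq_measure by simp
qed simp

text \<open>Continuity from below along finite subfamilies extends the bound to countable chains.
  Null sets almost surely contain no sample point, so they are never exceeded.\<close>

lemma (in prob_space) measure_chain_exceedance:
  fixes e :: real and I :: "'i set"
  assumes "finite I" "countable \<A>" "\<A> \<subseteq> sets M"
    and chain: "\<And>A B. A \<in> \<A> \<Longrightarrow> B \<in> \<A> \<Longrightarrow> A \<subseteq> B \<or> B \<subseteq> A"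
    and "0 < e"
  shows "measure (PiM I (\<lambda>_. M)) {x \<in> space (PiM I (\<lambda>_. M)).
      \<exists>A\<in>\<A>. card I * (prob A + e) < (\<Sum>i\<in>I. indicator A (x i))} \<le> exp (- 2 * real (card I) * e\<^sup>2)"
proof (cases "e < 1")
  case True
  interpret PI: product_prob_space "\<lambda>_. M" I ..
  let ?P = "PiM I (\<lambda>_. M)" and ?n = "real (card I)"
  define C where "C A x \<longleftrightarrow> ?n * (prob A + e) < (\<Sum>i\<in>I. indicator A (x i))"
    for A :: "'a set" and x :: "'i \<Rightarrow> 'a"
  define E where "E \<B> = {x \<in> space ?P. \<exists>A\<in>\<B>. C A x}" for \<B>
  \<comment> \<open>The weights of the finite case divide by \<open>prob A\<close>, so null sets are
    handled separately.\<close>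
  define \<A>' where "\<A>' = {A \<in> \<A>. 0 < prob A}"
  have C_meas: "Measurable.pred ?P (C A)" if "A \<in> sets M" for A
  proof -
    note [measurable] = that
    show ?thesis unfolding C_def by measurable
  qed
  have E_meas: "E \<B> \<in> sets ?P" if "\<B> \<subseteq> \<A>" for \<B>
  proof -
    have "E \<B> = (\<Union>A\<in>\<B>. {x \<in> space ?P. C A x})" by (auto simp: E_def)
    moreover have "(\<Union>A\<in>\<B>. {x \<in> space ?P. C A x}) \<in> sets ?P"
      using that \<open>\<A> \<subseteq> sets M\<close> countable_subset[OF that \<open>countable \<A>\<close>]
      by (intro sets.countable_UN'' predE C_meas) auto
    ultimately show ?thesis by simp
  qed
  have bound: "emeasure ?P (E \<A>') \<le> exp (- 2 * ?n * e\<^sup>2)"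
  proof (cases "\<A>' = {}")
    case False
    define F where "F m = from_nat_into \<A>' ` {..m}" for m :: nat
    have "countable \<A>'" using \<open>countable \<A>\<close> by (simp add: \<A>'_def)
    have F: "F m \<subseteq> \<A>'" "finite (F m)" for m
      using from_nat_into[OF False] by (auto simp: F_def)
    have "emeasure ?P (E (F m)) \<le> exp (- 2 * ?n * e\<^sup>2)" for m
      unfolding E_def C_def
    proof (rule emeasure_chain_exceedance_finite)
      show "F m \<subseteq> sets M" "\<And>A. A \<in> F m \<Longrightarrow> 0 < prob A"
        using F(1)[of m] \<open>\<A> \<subseteq> sets M\<close> by (auto simp: \<A>'_def)
      show "\<And>A B. A \<in> F m \<Longrightarrow> B \<in> F m \<Longrightarrow> A \<subseteq> B \<or> B \<subseteq> A"
        using F(1)[of m] chain by (auto simp: \<A>'_def)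
    qed (use F True assms in auto)
    moreover have "E \<A>' = (\<Union>m. E (F m))"
    proof -
      have "\<A>' = (\<Union>m. F m)"
      proof -
        have "(\<Union>m. F m) = range (from_nat_into \<A>')" by (auto simp: F_def)
        then show ?thesis using range_from_nat_into[OF False \<open>countable \<A>'\<close>] by simp
      qed
      then show ?thesis by (auto simp: E_def)
    qed
    moreover have "(SUP m. emeasure ?P (E (F m))) = emeasure ?P (\<Union>m. E (F m))"
    proof (rule SUP_emeasure_incseq)
      show "range (\<lambda>m. E (F m)) \<subseteq> sets ?P"
      proof -
        have "F m \<subseteq> \<A>" for m using F(1)[of m] by (auto simp: \<A>'_def)
        then show ?thesis using E_meas by auto
      qed
      show "incseq (\<lambda>m. E (F m))"
        by (rule incseq_SucI) (auto simp: E_def F_def)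
    qed
    ultimately show ?thesis by (metis SUP_least)
  qed (simp add: E_def)
  have "AE x in ?P. \<forall>A\<in>\<A> - \<A>'. \<forall>i\<in>I. x i \<notin> A"
  proof -
    have "AE x in ?P. x i \<notin> A" if "A \<in> \<A> - \<A>'" "i \<in> I" for A i
    proof (rule AE_PiM_component)
      have "A \<in> null_sets M"
        using that assms(3) by (auto simp: \<A>'_def null_sets_def emeasure_eq_measure zero_less_measure_iff)
      then show "AE y in M. y \<notin> A" by (rule AE_not_in)
    qed (use that in \<open>auto intro: prob_space_axioms\<close>)
    then show ?thesis
      using \<open>countable \<A>\<close> \<open>finite I\<close> by (auto simp: AE_ball_countable AE_finite_all countable_finite)
  qed
  then have "AE x in ?P. x \<in> E \<A> \<longrightarrow> x \<in> E \<A>'"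
  proof eventually_elim
    case (elim x)
    have "\<not> C A x" if "A \<in> \<A> - \<A>'" for A
    proof -
      have "(\<Sum>i\<in>I. indicator A (x i)) = (0 :: real)"
        using elim that by (intro sum.neutral) auto
      moreover have "0 \<le> ?n * (prob A + e)" using \<open>0 < e\<close> by simp
      ultimately show ?thesis by (simp add: C_def)
    qed
    then show ?case by (auto simp: E_def)
  qed
  then have "emeasure ?P (E \<A>) \<le> emeasure ?P (E \<A>')"
    using E_meas[of \<A>'] by (intro emeasure_mono_AE) (auto simp: \<A>'_def)
  with bound have "emeasure ?P (E \<A>) \<le> exp (- 2 * ?n * e\<^sup>2)" by (rule order_trans[rotated])
  then show ?thesis by (simp add: PI.emeasure_eq_measure E_def C_def)
next
  case False
  \<comment> \<open>A count never exceeds \<open>card I\<close>, so for \<open>e \<ge> 1\<close> no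
    exceedance can occur.\<close>
  have "\<not> card I * (prob A + e) < (\<Sum>i\<in>I. indicator A (x i))" for A and x :: "'i \<Rightarrow> 'a"
  proof -
    have "(\<Sum>i\<in>I. indicator A (x i)) \<le> (\<Sum>i\<in>I. 1 :: real)"
      by (intro sum_mono) (auto split: split_indicator)
    also have "\<dots> \<le> card I * (prob A + e)"
      using False mult_left_mono[of 1 "prob A + e" "real (card I)"] by (simp add: add_increasing)
    finally show ?thesis by simp
  qed
  then show ?thesis by simp
qed

text \<open>Independence and the common law make the joint law of the sample a product measure,
  which transfers the bound. The countable index type makes the event measurable.\<close>

lemma (in prob_space) prob_iid_chain_exceedance:
  fixes A :: "'c::countable \<Rightarrow> 'b set" and X :: "'i \<Rightarrow> 'a \<Rightarrow> 'b" and e :: real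
  assumes "finite I" "I \<noteq> {}" "indep_vars (\<lambda>_. N) X I"
    and D: "\<And>i. i \<in> I \<Longrightarrow> distr M N (X i) = D"
    and A [measurable]: "\<And>c. A c \<in> sets N"
    and chain: "\<And>c d. A c \<subseteq> A d \<or> A d \<subseteq> A c"
    and "0 < e"
  shows "prob {\<omega> \<in> space M. \<exists>c. card I * (measure D (A c) + e) < (\<Sum>i\<in>I. indicator (A c) (X i \<omega>))}
      \<le> exp (- 2 * real (card I) * e\<^sup>2)"
proof -
  have X [measurable]: "X i \<in> M \<rightarrow>\<^sub>M N" if "i \<in> I" for i
    using assms(3) that unfolding indep_vars_def by simp
  obtain i where i: "i \<in> I" using \<open>I \<noteq> {}\<close> by auto
  interpret D: prob_space D
    using prob_space_distr[OF X[OF i]] D[OF i] by simp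
  have sets_D [simp]: "sets D = sets N" using D[OF i] by (metis sets_distr)
  have A_D [measurable]: "A c \<in> sets D" for c using A by simp
  let ?P = "PiM I (\<lambda>_. D)" and ?T = "\<lambda>\<omega>. \<lambda>i\<in>I. X i \<omega>"
  let ?C = "\<lambda>x. \<exists>c. card I * (measure D (A c) + e) < (\<Sum>i\<in>I. indicator (A c) (x i))"
  have T: "?T \<in> M \<rightarrow>\<^sub>M PiM I (\<lambda>_. N)" by measurable
  have "distr M (PiM I (\<lambda>_. N)) ?T = PiM I (\<lambda>i. distr M N (X i))"
    using indep_vars_iff_distr_eq_PiM'[of I X "\<lambda>_. N"] X assms(2,3) by simp
  also have "\<dots> = ?P" by (intro PiM_cong) (auto simp: D)
  finally have P: "distr M (PiM I (\<lambda>_. N)) ?T = ?P" .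
  have space_P: "space ?P = space (PiM I (\<lambda>_. N))"
    and sets_P: "sets ?P = sets (PiM I (\<lambda>_. N))"
    unfolding P[symmetric] by simp_all
  have "{x \<in> space ?P. ?C x} \<in> sets ?P" by measurable
  then have C: "{x \<in> space ?P. ?C x} \<in> sets (PiM I (\<lambda>_. N))"
    unfolding sets_P .
  have "{\<omega> \<in> space M. \<exists>c. card I * (measure D (A c) + e) < (\<Sum>i\<in>I. indicator (A c) (X i \<omega>))} =
      ?T -` {x \<in> space ?P. ?C x} \<inter> space M"
    using measurable_space[OF T] unfolding space_P by auto
  then have "prob {\<omega> \<in> space M. \<exists>c. card I * (measure D (A c) + e) < (\<Sum>i\<in>I. indicator (A c) (X i \<omega>))}
      = measure ?P {x \<in> space ?P. ?C x}"
    using measure_distr[OF T C] P by simp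
  also have "\<dots> \<le> exp (- 2 * real (card I) * e\<^sup>2)"
  proof -
    have "measure ?P {x \<in> space ?P.
        \<exists>B\<in>range A. card I * (measure D B + e) < (\<Sum>i\<in>I. indicator B (x i))}
      \<le> exp (- 2 * real (card I) * e\<^sup>2)"
    proof (rule D.measure_chain_exceedance)
      show "B \<subseteq> C \<or> C \<subseteq> B" if BC: "B \<in> range A" "C \<in> range A" for B C
      proof -
        obtain c d where "B = A c" "C = A d" using BC by auto
        then show ?thesis using chain[of c d] by simp
      qed
    qed (use assms(1) \<open>0 < e\<close> A_D in auto)
    then show ?thesis by simp
  qed
  finally show ?thesis .
qed

subsection \<open>Coverage of the quantiles\<close>

text \<open>Right-continuity of the mass of \<open>{0..x}\<close> makes the infimum of the
  admissible points a minimum, so \<open>LEAST\<close> is well defined. The equivalence is the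
  Galois connection through which quantiles are handled from here on.\<close>

lemma quantile:
  assumes "finite_measure P" and [simp]: "sets P = sets borel"
    and "0 \<le> R" "\<alpha> \<le> measure P {0..R}"
  shows quantile_mem: "quantile R P \<alpha> \<in> {0..R}"
    and quantile_le_iff: "x \<in> {0..R} \<Longrightarrow> quantile R P \<alpha> \<le> x \<longleftrightarrow> \<alpha> \<le> measure P {0..x}"
proof -
  interpret finite_measure P by fact
  define S where "S = {x \<in> {0..R}. \<alpha> \<le> measure P {0..x}}"
  have S: "R \<in> S" "bdd_below S" using assms by (auto simp: S_def intro!: bdd_belowI[of _ 0])
  define q where "q = Inf S"
  have q_le: "q \<le> x" if "x \<in> S" for x
    unfolding q_def using that S by (intro cInf_lower)
  have "0 \<le> q" unfolding q_def using S by (intro cInf_greatest) (auto simp: S_def)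
  \<comment> \<open>Continuity from above; each of these intervals contains \<open>{0..s}\<close>
    for some admissible \<open>s\<close>, so its mass is at least \<open>\<alpha>\<close>.\<close>
  have "(\<lambda>k. measure P {0..q + 1 / Suc k}) \<longlonglongrightarrow> measure P (\<Inter>k. {0..q + 1 / Suc k})"
    by (intro finite_Lim_measure_decseq) (auto simp: decseq_def frac_le intro: order_trans add_left_mono)
  moreover have "(\<Inter>k. {0..q + 1 / Suc k}) = {0..q}"
  proof -
    have "x \<le> q" if "\<And>k. x \<le> q + 1 / Suc k" for x
    proof (rule field_le_epsilon)
      fix d :: real assume "0 < d"
      then obtain k where "1 / Suc k < d" by (rule nat_approx_posE)
      then show "x \<le> q + d" using that[of k] by simp
    qed
    moreover have "x \<le> q + 1 / Suc k" if "x \<le> q" for x k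
      using that by (rule add_increasing2[rotated]) simp
    ultimately have iff: "(\<forall>k. x \<le> q + 1 / Suc k) \<longleftrightarrow> x \<le> q" for x by metis
    have "(\<Inter>k. {0..q + 1 / Suc k}) = {x. 0 \<le> x \<and> (\<forall>k. x \<le> q + 1 / Suc k)}" by auto
    also have "\<dots> = {0..q}" unfolding iff by auto
    finally show ?thesis .
  qed
  moreover have "\<alpha> \<le> measure P {0..q + 1 / Suc k}" for k
  proof -
    have "\<exists>s\<in>S. s < q + 1 / Suc k"
      using S by (intro cInf_lessD) (auto simp: q_def[symmetric])
    then obtain s where "s \<in> S" "s \<le> q + 1 / Suc k" by auto
    then have "\<alpha> \<le> measure P {0..s}" by (simp add: S_def)
    also have "\<dots> \<le> measure P {0..q + 1 / Suc k}"
      using \<open>s \<le> _\<close> by (intro finite_measure_mono) auto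
    finally show ?thesis .
  qed
  ultimately have "\<alpha> \<le> measure P {0..q}" by (intro LIMSEQ_le_const) auto
  then have q: "q \<in> S" using \<open>0 \<le> q\<close> q_le[OF S(1)] by (simp add: S_def)
  have eq: "quantile R P \<alpha> = q"
    unfolding quantile_def using q q_le by (intro Least_equality) (auto simp: S_def)
  show "quantile R P \<alpha> \<in> {0..R}" using q by (simp add: eq S_def)
  show "quantile R P \<alpha> \<le> x \<longleftrightarrow> \<alpha> \<le> measure P {0..x}" if x: "x \<in> {0..R}" for x
  proof
    assume "quantile R P \<alpha> \<le> x"
    then have "measure P {0..q} \<le> measure P {0..x}"
      by (intro finite_measure_mono) (auto simp: eq)
    then show "\<alpha> \<le> measure P {0..x}" using q by (simp add: S_def)
  next
    assume "\<alpha> \<le> measure P {0..x}"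
    then show "quantile R P \<alpha> \<le> x" using x q_le by (simp add: eq S_def)
  qed
qed

text \<open>Moves a strict inequality to a rational point on the left, as
  \<open>isCont_less_ex_rat\<close> does on the right, since the bounds to be applied hold at
  rationals only.\<close>

lemma isCont_gt_ex_rat:
  fixes F :: "real \<Rightarrow> real"
  assumes "isCont F q" "v < F q"
  shows "\<exists>y::rat. of_rat y < q \<and> v < F (of_rat y)"
proof -
  have "eventually (\<lambda>y. v < F y) (at_left q)"
    using assms by (intro order_tendstoD(1)) (auto simp: isCont_def intro: filterlim_at_split[THEN iffD1, THEN conjunct1])
  then obtain b where "b < q" "\<And>y. b < y \<Longrightarrow> y < q \<Longrightarrow> v < F y"
    by (auto simp: eventually_at_left_field)
  then show ?thesis using of_rat_dense[of b q] by blast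
qed

lemma isCont_less_ex_rat:
  fixes F :: "real \<Rightarrow> real"
  assumes "isCont F q" "F q < v"
  shows "\<exists>y::rat. q < of_rat y \<and> F (of_rat y) < v"
proof -
  have "eventually (\<lambda>y. F y < v) (at_right q)"
    using assms by (intro order_tendstoD(2)) (auto simp: isCont_def intro: filterlim_at_split[THEN iffD1, THEN conjunct2])
  then obtain b where "q < b" "\<And>y. q < y \<Longrightarrow> y < b \<Longrightarrow> F y < v"
    by (auto simp: eventually_at_right_field)
  then show ?thesis using of_rat_dense[of q b] by blast
qed

text \<open>Reduces the event of the theorem to a countable intersection, hence gives its measurability.\<close>

lemma quantile_coverage_rat:
  fixes F :: "real \<Rightarrow> real"
  assumes P: "finite_measure P" "sets P = sets borel" "1 \<le> measure P {0..R}" "0 \<le> R"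
    and F: "continuous_on UNIV F" "mono F" "\<And>x. x < 0 \<Longrightarrow> F x = 0"
    and "0 \<le> e2"
    and rat: "\<And>\<alpha>::rat. 0 \<le> \<alpha> \<Longrightarrow> \<alpha> \<le> 1 \<Longrightarrow>
      of_rat \<alpha> - e1 \<le> F (quantile R P (of_rat \<alpha>)) \<and> F (quantile R P (of_rat \<alpha>)) \<le> of_rat \<alpha> + e2"
    and \<alpha>: "0 \<le> \<alpha>" "\<alpha> \<le> 1"
  shows "\<alpha> - e1 \<le> F (quantile R P \<alpha>)" "F (quantile R P \<alpha>) \<le> \<alpha> + e2"
proof -
  note q = quantile[OF P(1,2,4)]
  have cont: "isCont F x" for x using F(1) by (simp add: continuous_on_eq_continuous_at)
  have iff: "quantile R P a \<le> x \<longleftrightarrow> a \<le> measure P {0..x}" if "a \<le> 1" "x \<in> {0..R}" for a x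
    using that P(3) by (intro q(2)) auto
  have q\<alpha>: "quantile R P \<alpha> \<in> {0..R}" using \<alpha> P(3) by (intro q(1)) simp
  show "\<alpha> - e1 \<le> F (quantile R P \<alpha>)"
  proof (cases "\<alpha> = 0")
    case True
    then show ?thesis using rat[of 0] by simp
  next
    case False
    show ?thesis
    proof (rule ccontr)
      assume "\<not> ?thesis"
      \<comment> \<open>A rational just below \<open>\<alpha>\<close> still violates the bound,
        because its quantile is no larger. The maximum with 0 keeps it in the unit interval;
        \<open>\<alpha> = 0\<close> is itself rational.\<close>
      then have "max 0 (F (quantile R P \<alpha>) + e1) < \<alpha>" using False \<alpha> by simp
      then obtain b :: rat where b: "max 0 (F (quantile R P \<alpha>) + e1) < of_rat b" "of_rat b < \<alpha>"
        using of_rat_dense by blast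
      have b1: "(of_rat b :: real) \<le> 1" "(0 :: real) \<le> of_rat b" using b \<alpha> by linarith+
      then have b01: "0 \<le> b" "b \<le> 1" by simp_all
      have "of_rat b \<le> measure P {0..quantile R P \<alpha>}"
        using iff[OF \<alpha>(2) q\<alpha>] b(2) by simp
      then have "quantile R P (of_rat b) \<le> quantile R P \<alpha>"
        using iff[OF b1(1) q\<alpha>] by simp
      then have "F (quantile R P (of_rat b)) \<le> F (quantile R P \<alpha>)" using F(2) by (rule monoD[rotated])
      then show False using rat[OF b01(1,2)] b by simp
    qed
  qed
  show "F (quantile R P \<alpha>) \<le> \<alpha> + e2"
  proof (rule ccontr)
    assume "\<not> ?thesis"
    \<comment> \<open>By continuity of \<open>F\<close> a point just left of the quantile violates
      the bound too. Its mass is below \<open>\<alpha>\<close>, leaving room for a rational level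
      \<open>b\<close> whose quantile still lies to the right of \<open>y\<close>.\<close>
    then obtain y where y: "y < quantile R P \<alpha>" "\<alpha> + e2 < F y"
      using isCont_gt_ex_rat[OF cont, of "\<alpha> + e2" "quantile R P \<alpha>"] by auto
    then have "0 \<le> y" using F(3)[of y] \<alpha> \<open>0 \<le> e2\<close> by force
    then have y_mem: "y \<in> {0..R}" using y q\<alpha> by simp
    then have "measure P {0..y} < \<alpha>" using y iff[OF \<alpha>(2) y_mem] by simp
    then obtain b :: rat where b: "measure P {0..y} < of_rat b" "of_rat b < \<alpha>"
      using of_rat_dense by blast
    moreover have "0 < (of_rat b :: real)" using b(1) measure_nonneg[of P "{0..y}"] by linarith
    ultimately have b1: "(of_rat b :: real) \<le> 1" "(0 :: real) \<le> of_rat b" using \<alpha> by linarith+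
    then have b01: "0 \<le> b" "b \<le> 1" by simp_all
    have "y < quantile R P (of_rat b)"
      using iff[OF b1(1) y_mem] b(1) by simp
    then have "F y \<le> F (quantile R P (of_rat b))" by (intro monoD[OF F(2)] less_imp_le)
    then show False using rat[OF b01(1,2)] b y by simp
  qed
qed

text \<open>The prior contributes between 0 and \<open>c\<close> to the mixture, so inverting the
  mixture shifts the level of \<open>Fn\<close> by at most \<open>c / (1 - c)\<close>; passing from
  \<open>Fn\<close> to \<open>F\<close> costs \<open>e\<close>.\<close>

lemma quantile_coverage_of_close:
  fixes F Fn p :: "real \<Rightarrow> real"
  assumes P: "finite_measure P" "sets P = sets borel" "1 \<le> measure P {0..R}" "0 \<le> R"
    and G: "\<And>x. x \<in> {0..R} \<Longrightarrow> measure P {0..x} = c * p x + (1 - c) * Fn x"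
    and p: "\<And>x. 0 \<le> p x" "\<And>x. p x \<le> 1" and c: "0 < c" "c < 1" and "mono Fn"
    and F: "continuous_on UNIV F" "\<And>x. x < 0 \<Longrightarrow> F x = 0"
    and close: "\<And>x::rat. Fn (of_rat x) \<le> F (of_rat x) + e" "\<And>x::rat. F (of_rat x) \<le> Fn (of_rat x) + e"
    and "0 \<le> e" and \<alpha>: "0 \<le> \<alpha>" "\<alpha> \<le> 1"
  shows "\<alpha> - e - c / (1 - c) \<le> F (quantile R P \<alpha>)" "F (quantile R P \<alpha>) \<le> \<alpha> + e + c / (1 - c)"
proof -
  note q = quantile[OF P(1,2,4)]
  let ?q = "quantile R P \<alpha>"
  have cont: "isCont F x" for x using F(1) by (simp add: continuous_on_eq_continuous_at)
  have q\<alpha>: "?q \<in> {0..R}" using q \<alpha> P by auto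
  have cc: "(1 - c) * (c / (1 - c)) = c" using c by simp
  \<comment> \<open>A violation at \<open>?q\<close> would persist at a rational just to its right:
    \<open>F\<close> is continuous there and \<open>Fn\<close> can only grow.\<close>
  have "Fn ?q \<le> F ?q + e"
  proof (rule ccontr)
    assume "\<not> ?thesis"
    then obtain y :: rat where "?q < of_rat y" "F (of_rat y) < Fn ?q - e"
      using isCont_less_ex_rat[OF cont, of ?q "Fn ?q - e"] by auto
    then show False using monoD[OF \<open>mono Fn\<close>, of ?q "of_rat y"] close(1)[of y] by simp
  qed
  moreover have "\<alpha> - c / (1 - c) \<le> Fn ?q"
  proof -
    have "\<alpha> \<le> c * p ?q + (1 - c) * Fn ?q"
      using q(2)[of \<alpha> ?q] q\<alpha> \<alpha> P G[OF q\<alpha>] by auto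
    moreover have "c * p ?q \<le> c" using p(2)[of ?q] c by (simp add: mult_left_le)
    moreover have "0 \<le> c * \<alpha>" using c \<alpha> by simp
    moreover have "(1 - c) * (\<alpha> - c / (1 - c)) = \<alpha> - c * \<alpha> - c"
      unfolding right_diff_distrib cc by (simp add: algebra_simps)
    ultimately have "(1 - c) * (\<alpha> - c / (1 - c)) \<le> (1 - c) * Fn ?q"
      by linarith
    then show ?thesis using c by simp
  qed
  ultimately show "\<alpha> - e - c / (1 - c) \<le> F ?q" by simp
  show "F ?q \<le> \<alpha> + e + c / (1 - c)"
  proof (rule ccontr)
    assume "\<not> ?thesis"
    \<comment> \<open>Strictly left of the quantile the mixture has mass below
      \<open>\<alpha>\<close>. Continuity of \<open>F\<close> lets the argument run there, so the
      jump of \<open>Fn\<close> at the quantile costs nothing.\<close>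
    then obtain r :: rat where r: "of_rat r < ?q" "\<alpha> + e + c / (1 - c) < F (of_rat r)"
      using isCont_gt_ex_rat[OF cont, of "\<alpha> + e + c / (1 - c)" ?q] by auto
    define y :: real where "y = of_rat r"
    have y: "y < ?q" "\<alpha> + e + c / (1 - c) < F y" using r by (auto simp: y_def)
    have "0 < c / (1 - c)" using c by simp
    then have "0 \<le> y" using F(2)[of y] \<alpha> \<open>0 \<le> e\<close> y by force
    then have y_mem: "y \<in> {0..R}" using y q\<alpha> by simp
    have "c * p y + (1 - c) * Fn y < \<alpha>"
      using y q(2)[of \<alpha> y, OF _ y_mem] \<alpha>(2) P(3) G[OF y_mem] by simp
    moreover have "0 \<le> c * p y" using p(1) c by simp
    moreover have "c * \<alpha> \<le> c" using c \<alpha> by (simp add: mult_left_le)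
    moreover have "(1 - c) * (\<alpha> + c / (1 - c)) = \<alpha> - c * \<alpha> + c"
      unfolding distrib_left cc by (simp add: algebra_simps)
    ultimately have "(1 - c) * Fn y \<le> (1 - c) * (\<alpha> + c / (1 - c))"
      by linarith
    then have "Fn y \<le> \<alpha> + c / (1 - c)" using c by simp
    then show False using close(2)[of r] y by (simp add: y_def)
  qed
qed

section \<open>Probabilities under mixtures and empirical distributions\<close>

lemma measure_mixture:
  assumes "prob_space P" "prob_space Q" "sets P = sets borel" "sets Q = sets borel"
    and c: "0 \<le> c" "c \<le> 1"
  shows prob_space_mixture: "prob_space (mixture c P Q)"
    and "A \<in> sets borel \<Longrightarrow> measure (mixture c P Q) A = c * measure P A + (1 - c) * measure Q A"
proof -
  interpret P: prob_space P by fact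
  interpret Q: prob_space Q by fact
  have *: "emeasure (mixture c P Q) A = ennreal (c * measure P A + (1 - c) * measure Q A)"
    if "A \<in> sets borel" for A
    using c by (simp add: emeasure_mixture[OF assms(3,4) that] P.emeasure_eq_measure
        Q.emeasure_eq_measure ennreal_plus ennreal_mult)
  show "prob_space (mixture c P Q)"
  proof
    have "space P = UNIV" "space Q = UNIV"
      using assms(3,4) by (metis sets_eq_imp_space_eq space_borel)+
    then have "measure P UNIV = 1" "measure Q UNIV = 1"
      using P.prob_space Q.prob_space by simp_all
    then show "emeasure (mixture c P Q) (space (mixture c P Q)) = 1"
      using *[of UNIV] by simp
  qed
  show "measure (mixture c P Q) A = c * measure P A + (1 - c) * measure Q A"
    if "A \<in> sets borel"
    unfolding measure_def[of "mixture c P Q"] *[OF that]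
    using c by (intro enn2real_ennreal) simp
qed

lemma measure_empirical_distribution:
  assumes "1 \<le> n"
  shows prob_space_empirical_distribution: "prob_space (empirical_distribution n x)"
    and "A \<in> sets borel \<Longrightarrow>
      measure (empirical_distribution n x) A = (\<Sum>i\<in>{1..n}. indicator A (x i)) / n"
proof -
  have x: "x \<in> uniform_count_measure {1..n} \<rightarrow>\<^sub>M borel"
    by (simp add: measurable_def space_uniform_count_measure sets_uniform_count_measure)
  have "prob_space (uniform_count_measure {1..n})"
    using assms by (intro prob_space_uniform_count_measure) auto
  then show "prob_space (empirical_distribution n x)"
    unfolding empirical_distribution_def using x by (rule prob_space.prob_space_distr)
  assume "A \<in> sets borel"
  then have "measure (empirical_distribution n x) A =
      measure (uniform_count_measure {1..n}) (x -` A \<inter> {1..n})"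
    unfolding empirical_distribution_def using x
    by (simp add: measure_distr space_uniform_count_measure)
  also have "\<dots> = card (x -` A \<inter> {1..n}) / n"
    by (subst measure_uniform_count_measure) auto
  also have "real (card (x -` A \<inter> {1..n})) = (\<Sum>i\<in>{1..n}. indicator A (x i))"
    by (simp add: indicator_def sum.If_cases Int_def vimage_def conj_commute)
  finally show "measure (empirical_distribution n x) A = (\<Sum>i\<in>{1..n}. indicator A (x i)) / n" .
qed

section \<open>Coverage of the regularized-belief quantiles under i.i.d. sampling\<close>

theorem theorem3:
  fixes M :: "'a measure" and r :: "nat \<Rightarrow> 'a \<Rightarrow> real"
    and P0 D :: "real measure" and R \<delta> :: real and t :: nat
  assumes "R > 0"
    and "distribution_on R P0" and "has_positive_density_on R P0"
    and "distribution_on R D" and "continuous_on UNIV (cdf D)"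
    and "prob_space M"
    and "prob_space.indep_vars M (\<lambda>_. borel) r {1..}"
    and "\<And>i. i \<ge> 1 \<Longrightarrow> distr M borel (r i) = D"
    and "\<And>i \<omega>. i \<ge> 1 \<Longrightarrow> \<omega> \<in> space M \<Longrightarrow> r i \<omega> \<in> {0..R}"
    and "t \<ge> 2" and "0 < \<delta>" and "\<delta> < 1"
  shows "\<P>(\<omega> in M. \<forall>\<alpha>\<in>{0..1}.
      let r\<^sub>t = algorithm_output R (\<lambda>s. 1 / sqrt (real s)) P0 (\<lambda>i. r i \<omega>) t \<alpha>
      in \<alpha> - sqrt (ln (2 / \<delta>) / (2 * (real t - 1))) - 1 / (sqrt (real t) - 1)
            \<le> \<P>(x in D. x \<le> r\<^sub>t)
       \<and> \<P>(x in D. x \<le> r\<^sub>t)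
            \<le> \<alpha> + sqrt (ln (2 / \<delta>) / (2 * (real t - 1))) + 1 / (sqrt (real t) - 1)
                + 1 / (real t - 1)) \<ge> 1 - \<delta>"
proof -
  interpret prob_space M by fact
  interpret P0: real_distribution P0 using assms(2) by (simp add: distribution_on_def)
  interpret D: real_distribution D using assms(4) by (simp add: distribution_on_def)
  define n where "n = t - 1"
  have n: "1 \<le> n" "real t - 1 = real n" using \<open>t \<ge> 2\<close> by (auto simp: n_def)
  define c where "c = 1 / sqrt (real t)"
  have "1 < sqrt (real t)" using \<open>t \<ge> 2\<close> by simp
  then have c: "0 < c" "c < 1" and c_eq: "c / (1 - c) = 1 / (sqrt (real t) - 1)"
    by (auto simp: c_def field_simps)
  define e where "e = sqrt (ln (2 / \<delta>) / (2 * (real t - 1)))"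
  have ln_pos: "0 < ln (2 / \<delta>)" using assms(11,12) by simp
  then have e: "0 < e" using n by (simp add: e_def)
  \<comment> \<open>\<open>e\<close> is calibrated so that each one-sided deviation has probability
    at most \<open>\<delta> / 2\<close>.\<close>
  have tail: "exp (- 2 * real n * e\<^sup>2) = \<delta> / 2"
  proof -
    have "e\<^sup>2 = ln (2 / \<delta>) / (2 * real n)" using n ln_pos by (simp add: e_def)
    then have "- 2 * real n * e\<^sup>2 = - ln (2 / \<delta>)" using n by simp
    then show ?thesis using \<open>0 < \<delta>\<close> by (simp add: exp_minus)
  qed
  let ?I = "{1..n}" and ?F = "cdf D"
  have I: "finite ?I" "?I \<noteq> {}" "card ?I = n" using n by auto
  have indep: "indep_vars (\<lambda>_. borel) r ?I"
    using assms(7) by (rule indep_vars_subset) auto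
  have r [measurable]: "r i \<in> borel_measurable M" if "i \<in> ?I" for i
    using indep that by (simp add: indep_vars_def)
  have D_eq: "distr M borel (r i) = D" if "i \<in> ?I" for i
    using assms(8) that by simp
  have F0: "?F x = 0" if "x < 0" for x
  proof -
    have "measure D {..x} \<le> measure D (space D - {0..R})"
      using that by (intro D.finite_measure_mono) auto
    also have "\<dots> = 0"
      using assms(4) by (subst D.prob_compl) (auto simp: distribution_on_def)
    finally show ?thesis by (simp add: cdf_def measure_le_0_iff)
  qed
  have F_mono: "mono ?F" by (intro monoI D.cdf_nondecreasing)
  have F_meas [measurable]: "?F \<in> borel_measurable borel"
    using assms(5) by (rule borel_measurable_continuous_onI)

  define S where "S \<omega> x = (\<Sum>i\<in>?I. indicator {..x} (r i \<omega>) :: real)" for \<omega> x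
  have S_meas [measurable]: "(\<lambda>\<omega>. S \<omega> x) \<in> borel_measurable M" for x
    unfolding S_def by measurable
  define Q where "Q \<omega> = regularized_belief (\<lambda>s. 1 / sqrt (real s)) P0 (\<lambda>i. r i \<omega>) t" for \<omega>
  have Q_eq: "Q \<omega> = mixture c P0 (empirical_distribution n (\<lambda>i. r i \<omega>))" for \<omega>
    by (simp add: Q_def regularized_belief_def c_def n_def)
  have emp: "prob_space (empirical_distribution n x)"
    "sets (empirical_distribution n x) = sets borel" for x
    using prob_space_empirical_distribution[OF n(1)] by (auto simp: empirical_distribution_def)
  have Q: "prob_space (Q \<omega>)" "sets (Q \<omega>) = sets borel" for \<omega>
    unfolding Q_eq using c by (auto intro!: prob_space_mixture emp P0.prob_space_axioms)
  \<comment> \<open>The sample points are nonnegative, so \<open>{0..x}\<close> and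
    \<open>{..x}\<close> contain the same ones and \<open>S \<omega> x / n\<close> is the empirical
    distribution function.\<close>
  have Q_cdf: "measure (Q \<omega>) {0..x} = c * measure P0 {0..x} + (1 - c) * (S \<omega> x / n)"
    if "\<omega> \<in> space M" for \<omega> x
  proof -
    have "(\<Sum>i\<in>?I. indicator {0..x} (r i \<omega>)) = S \<omega> x"
      unfolding S_def using assms(9) that by (intro sum.cong) (auto split: split_indicator)
    then show ?thesis
      unfolding Q_eq using c
      by (simp add: measure_mixture(2) emp P0.prob_space_axioms measure_empirical_distribution(2)[OF n(1)])
  qed
  have Q_R: "measure (Q \<omega>) {0..R} = 1" if "\<omega> \<in> space M" for \<omega>
  proof -
    have "S \<omega> R = n"
      unfolding S_def using assms(9) that by (subst sum.cong[OF refl, where h = "\<lambda>_. 1"]) auto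
    then show ?thesis
      using assms(2) n by (simp add: Q_cdf[OF that] distribution_on_def)
  qed
  note Qq = prob_space.finite_measure[OF Q(1)] Q(2) eq_refl[OF Q_R[symmetric]] less_imp_le[OF \<open>R > 0\<close>]

  \<comment> \<open>Measurability of the coverage event\<close>
  define L where "L \<omega> \<alpha> \<longleftrightarrow> \<alpha> - (e + c / (1 - c)) \<le> ?F (quantile R (Q \<omega>) \<alpha>) \<and>
      ?F (quantile R (Q \<omega>) \<alpha>) \<le> \<alpha> + (e + c / (1 - c) + 1 / n)" for \<omega> \<alpha>
  have pos: "0 \<le> e + c / (1 - c) + 1 / n" using e c by simp
  let ?E = "{\<omega> \<in> space M. \<forall>\<alpha>\<in>{0..1}. L \<omega> \<alpha>}"
  \<comment> \<open>\<open>measure\<close> is 0 outside the sigma-algebra, so \<open>?E\<close> has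
    to be shown measurable; restricting to rational levels makes it a countable
    intersection.\<close>
  have "?E = {\<omega> \<in> space M. \<forall>\<alpha>::rat. 0 \<le> \<alpha> \<longrightarrow> \<alpha> \<le> 1 \<longrightarrow> L \<omega> (of_rat \<alpha>)}" (is "_ = ?E'")
  proof
    show "?E' \<subseteq> ?E"
    proof (intro subsetI CollectI conjI ballI)
      fix \<omega> \<alpha> assume \<omega>: "\<omega> \<in> ?E'" and \<alpha>: "\<alpha> \<in> {0..1::real}"
      have rat: "L \<omega> (of_rat a)" if "0 \<le> a" "a \<le> 1" for a :: rat
        using \<omega> that by blast
      have "1 \<le> measure (Q \<omega>) {0..R}" using \<omega> Q_R by simp
      note cov = quantile_coverage_rat[OF Qq(1,2) this Qq(4) assms(5) F_mono F0 pos rat[unfolded L_def]]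
      show "L \<omega> \<alpha>"
        unfolding L_def using \<alpha> by (intro conjI cov) auto
    qed auto
  qed auto
  moreover have "?E' \<in> sets M"
  proof -
    \<comment> \<open>By the Galois connection the sublevel sets of the quantile are events about
      the measurable counts \<open>S \<omega> x\<close>.\<close>
    have "(\<lambda>\<omega>. quantile R (Q \<omega>) \<alpha>) \<in> borel_measurable M" if \<alpha>: "\<alpha> \<le> 1" for \<alpha>
    proof (rule borel_measurableI_le)
      fix x
      note q = quantile[OF Qq(1,2,4)]
      have le: "\<alpha> \<le> measure (Q \<omega>) {0..R}" if "\<omega> \<in> space M" for \<omega>
        using \<alpha> Q_R[OF that] by simp
      consider "x < 0" | "R < x" | "x \<in> {0..R}" by force
      then show "{\<omega> \<in> space M. quantile R (Q \<omega>) \<alpha> \<le> x} \<in> sets M"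
      proof cases
        case 1
        then have "{\<omega> \<in> space M. quantile R (Q \<omega>) \<alpha> \<le> x} = {}"
          using q(1)[OF le] by fastforce
        then show ?thesis by (simp only: sets.empty_sets)
      next
        case 2
        then have "{\<omega> \<in> space M. quantile R (Q \<omega>) \<alpha> \<le> x} = space M"
          using q(1)[OF le] by fastforce
        then show ?thesis by (simp only: sets.top)
      next
        case 3
        then have "{\<omega> \<in> space M. quantile R (Q \<omega>) \<alpha> \<le> x} =
            {\<omega> \<in> space M. \<alpha> \<le> c * measure P0 {0..x} + (1 - c) * (S \<omega> x / n)}"
          using q(2)[OF le 3] Q_cdf by auto
        also have "\<dots> \<in> sets M" by measurable
        finally show ?thesis .
      qed
    qed
    then have [measurable]: "(\<lambda>\<omega>. quantile R (Q \<omega>) (of_rat \<alpha>)) \<in> borel_measurable M"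
      if "\<alpha> \<le> 1" for \<alpha> :: rat
      using that by simp
    have "Measurable.pred M (\<lambda>\<omega>. L \<omega> (of_rat \<alpha>))" if "\<alpha> \<le> 1" for \<alpha> :: rat
      using that unfolding L_def by measurable
    then show ?thesis
      by (intro predE pred_intros_countable pred_intros_imp')
  qed
  ultimately have E_meas: "?E \<in> sets M" by (simp only:)

  \<comment> \<open>Uniform deviations of the empirical distribution function\<close>
  define B1 where "B1 = {\<omega> \<in> space M. \<exists>y::rat. card ?I * (measure D {..of_rat y} + e) <
      (\<Sum>i\<in>?I. indicator {..of_rat y} (r i \<omega>))}"
  \<comment> \<open>Upper half-lines turn a deficit of the empirical distribution function into an
    exceedance, so the same one-sided bound covers both events.\<close>
  define B2 where "B2 = {\<omega> \<in> space M. \<exists>y::rat. card ?I * (measure D {of_rat y<..} + e) <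
      (\<Sum>i\<in>?I. indicator {of_rat y<..} (r i \<omega>))}"
  have B_meas [measurable]: "B1 \<in> sets M" "B2 \<in> sets M"
    unfolding B1_def B2_def by measurable
  have "prob B1 \<le> \<delta> / 2"
    unfolding B1_def tail[symmetric]
    using prob_iid_chain_exceedance[OF I(1,2) indep D_eq, of "\<lambda>y::rat. {..of_rat y}" e] e I(3)
    by (auto simp: linear)
  moreover have "prob B2 \<le> \<delta> / 2"
    unfolding B2_def tail[symmetric]
    using prob_iid_chain_exceedance[OF I(1,2) indep D_eq, of "\<lambda>y::rat. {of_rat y<..}" e] e I(3)
    by (auto simp: linear)
  \<comment> \<open>Off both events the two distribution functions differ by at most
    \<open>e\<close> at every rational, and the rest is deterministic.\<close>
  moreover have "space M - (B1 \<union> B2) \<subseteq> ?E"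
  proof
    fix \<omega> assume \<omega>: "\<omega> \<in> space M - (B1 \<union> B2)"
    have upper: "S \<omega> (of_rat y) / n \<le> ?F (of_rat y) + e" for y :: rat
      using \<omega> n by (auto simp: B1_def S_def cdf_def field_simps not_less)
    have lower: "?F (of_rat y) \<le> S \<omega> (of_rat y) / n + e" for y :: rat
    proof -
      have "measure D {of_rat y<..} = 1 - ?F (of_rat y)"
        using D.prob_compl[of "{..of_rat y}"] by (simp add: cdf_def Compl_eq_Diff_UNIV[symmetric])
      moreover have "(\<Sum>i\<in>?I. indicator {of_rat y<..} (r i \<omega>)) = n - S \<omega> (of_rat y)"
      proof -
        have "(\<Sum>i\<in>?I. indicator {of_rat y<..} (r i \<omega>)) =
            (\<Sum>i\<in>?I. 1 - indicator {..of_rat y} (r i \<omega>) :: real)"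
          by (intro sum.cong) (auto split: split_indicator)
        then show ?thesis by (simp only: sum_subtractf S_def) simp
      qed
      moreover have "(\<Sum>i\<in>?I. indicator {of_rat y<..} (r i \<omega>)) \<le>
          card ?I * (measure D {of_rat y<..} + e)"
        using \<omega> by (auto simp: B2_def not_less)
      ultimately have "n - S \<omega> (of_rat y) \<le> n * (1 - ?F (of_rat y) + e)"
        by (simp only: I(3))
      then show ?thesis using n by (simp add: field_simps)
    qed
    have S_mono: "mono (\<lambda>x. S \<omega> x / n)"
      unfolding S_def
      by (intro monoI divide_right_mono sum_mono) (auto split: split_indicator)
    have \<omega>': "\<omega> \<in> space M" using \<omega> by simp
    have "1 \<le> measure (Q \<omega>) {0..R}" using Q_R[OF \<omega>'] by simp
    note cov = quantile_coverage_of_close[where p = "\<lambda>x. measure P0 {0..x}" and Fn = "\<lambda>x. S \<omega> x / n",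
        OF Qq(1,2) this Qq(4) Q_cdf[OF \<omega>'] measure_nonneg P0.prob_le_1 c S_mono assms(5) F0
        upper lower less_imp_le[OF e]]
    have "L \<omega> \<alpha>" if "\<alpha> \<in> {0..1}" for \<alpha>
    proof -
      have \<alpha>: "0 \<le> \<alpha>" "\<alpha> \<le> 1" using that by auto
      \<comment> \<open>\<open>cov\<close> bounds the coverage above by
        \<open>\<alpha> + e + c / (1 - c)\<close>; nonnegativity of \<open>1 / n\<close> weakens
        this to the form in \<open>L\<close>.\<close>
      have "0 \<le> 1 / real n" by simp
      then show ?thesis
        using cov[OF _ \<alpha>] unfolding L_def by linarith
    qed
    then show "\<omega> \<in> ?E" using \<omega> by auto
  qed
  then have "prob (space M - (B1 \<union> B2)) \<le> prob ?E"
    using E_meas by (rule finite_measure_mono)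
  moreover have "prob (space M - (B1 \<union> B2)) = 1 - prob (B1 \<union> B2)"
    using B_meas by (intro prob_compl) auto
  moreover have "prob (B1 \<union> B2) \<le> prob B1 + prob B2"
    using B_meas by (intro measure_Un_le)
  ultimately have "1 - \<delta> \<le> prob ?E" by linarith
  moreover have "measure D {x \<in> space D. x \<le> y} = ?F y" for y
    by (simp add: cdf_def atMost_def)
  ultimately show ?thesis
    unfolding L_def c_eq Q_def e_def n(2)[symmetric] Let_def algorithm_output_def
    by (simp only: diff_diff_eq add.assoc)
qed

end
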